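(* For every positive integer $n$ and every fixed pair $(l,m)$ of non-negative integers, the sequence $(p_{n,k})_{1\le k\le n}$ is log-concave, where $p_{n,k}=p_{n,k}^{(l,m)}$ is the number of $(l,m)$-protected SYT of size $n$ whose first row has length $k$.
   Context: Log-concave means $p_{n,k-1}\,p_{n,k+1}\le p_{n,k}^2$ for all $k$ with $2\le k\le n-1$ (some entries may be $0$). A Standard Young Tableau (SYT) of size $n$ is a filling of a Ferrers diagram (English notation) with $n$ boxes by $1,\dots,n$, each used once, increasing along rows and down columns. The protected area of a SYT $T$ is obtained from $T$ by removing as many boxes as possible in the first row and in the first column of $T$ without creating a shape that is no longer a Ferrers diagram (the box $(1,1)$ is never removed, so if $T$ is a hook, i.e. has shape $(k,1,\dots,1)$, its protected area is the single box containing $1$). Explicitly, if the shape $\lambda$ of $T$ contains the box $(2,2)$, one removes the boxes of the first row lying in columns $>\lambda_2$ and the boxes of the first column lying in rows $>\lambda'_2$, where $\lambda'$ is the conjugate partition. The removed elements form the surplus of $T$. If all elements contained in the surplus of $T$ are larger than all elements contained in the first row and first column of its protected area, and the protected area has size $m$ with $l$ of its elements in the first row, then $T$ is called $(l,m)$-protected. *)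

theory Defs
  imports "HOL-Library.FuncSet"
begin

text \<open>
  A box is a pair (row, column), both counted from 1, in English notation: row 1 is the topmost row,
  column 1 the leftmost column.
\<close>

type_synonym box = "nat \<times> nat"

definition ferrers_diagram :: "box set \<Rightarrow> bool" where
  "ferrers_diagram D \<longleftrightarrow> finite D \<and> D \<subseteq> {1..} \<times> {1..} \<and>
     (\<forall>i j i' j'. (i, j) \<in> D \<and> 1 \<le> i' \<and> i' \<le> i \<and> 1 \<le> j' \<and> j' \<le> j \<longrightarrow> (i', j') \<in> D)"

text \<open>
  \<open>row_len D i\<close> is the part \<open>\<lambda>\<^sub>i\<close> of the partition \<open>\<lambda>\<close> whose diagram is \<open>D\<close>, and \<open>col_len D j\<close> is the part
  \<open>\<lambda>'\<^sub>j\<close> of its conjugate.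
\<close>

definition row_len :: "box set \<Rightarrow> nat \<Rightarrow> nat" where
  "row_len D i = card {j. (i, j) \<in> D}"

definition col_len :: "box set \<Rightarrow> nat \<Rightarrow> nat" where
  "col_len D j = card {i. (i, j) \<in> D}"

text \<open>
  A tableau is a shape together with a filling; requiring the filling to be \<^term>\<open>undefined\<close> off the
  shape makes distinct pairs distinct tableaux, so that tableaux can be counted with \<^const>\<open>card\<close>.
\<close>

definition SYT :: "nat \<Rightarrow> (box set \<times> (box \<Rightarrow> nat)) set" where
  "SYT n = {(D, T). ferrers_diagram D \<and> T \<in> extensional D \<and> bij_betw T D {1..n} \<and>
     (\<forall>i j j'. (i, j) \<in> D \<and> (i, j') \<in> D \<and> j < j' \<longrightarrow> T (i, j) < T (i, j')) \<and>
     (\<forall>i i' j. (i, j) \<in> D \<and> (i', j) \<in> D \<and> i < i' \<longrightarrow> T (i, j) < T (i', j))}"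

text \<open>The second case is that of a hook, for nonempty \<open>D\<close>.\<close>

definition protected_area :: "box set \<Rightarrow> box set" where
  "protected_area D =
     (if (2, 2) \<in> D
      then D - {(1, j) | j. row_len D 2 < j} - {(i, 1) | i. col_len D 2 < i}
      else {(1, 1)})"

definition surplus :: "box set \<Rightarrow> box set" where
  "surplus D = D - protected_area D"

definition lm_protected :: "nat \<Rightarrow> nat \<Rightarrow> box set \<times> (box \<Rightarrow> nat) \<Rightarrow> bool" where
  "lm_protected l m = (\<lambda>(D, T).
     (\<forall>s \<in> surplus D. \<forall>b \<in> protected_area D. fst b = 1 \<or> snd b = 1 \<longrightarrow> T b < T s) \<and>
     card (protected_area D) = m \<and>
     row_len (protected_area D) 1 = l)"

definition num_protected :: "nat \<Rightarrow> nat \<Rightarrow> nat \<Rightarrow> nat \<Rightarrow> nat" where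
  "num_protected l m n k =
     card {(D, T). (D, T) \<in> SYT n \<and> lm_protected l m (D, T) \<and> row_len D 1 = k}"

definition log_concave :: "nat \<Rightarrow> (nat \<Rightarrow> nat) \<Rightarrow> bool" where
  "log_concave n a \<longleftrightarrow> (\<forall>k. 2 \<le> k \<and> k \<le> n - 1 \<longrightarrow> a (k - 1) * a (k + 1) \<le> (a k)\<^sup>2)"


subsection \<open>Consistency of the definitions\<close>

lemma down_closed_eq_atLeastAtMost_card:
  fixes S :: "nat set"
  assumes "finite S" "S \<subseteq> {1..}" and dc: "\<And>x y. x \<in> S \<Longrightarrow> 1 \<le> y \<Longrightarrow> y \<le> x \<Longrightarrow> y \<in> S"
  shows "S = {1..card S}"
proof (cases "S = {}")
  case False
  have "S = {1..Max S}"
  proof (intro equalityI subsetI)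
    fix x assume "x \<in> S" then show "x \<in> {1..Max S}" using assms(1,2) by auto
  next
    fix x assume "x \<in> {1..Max S}"
    then show "x \<in> S" using dc[OF Max_in[OF assms(1) False], of x] by auto
  qed
  then show ?thesis by (metis card_atLeastAtMost diff_Suc_1)
qed auto

lemma ferrers_row:
  assumes "ferrers_diagram D" shows "{j. (i, j) \<in> D} = {1..row_len D i}"
  unfolding row_len_def
proof (rule down_closed_eq_atLeastAtMost_card)
  have "{j. (i, j) \<in> D} \<subseteq> snd ` D" by force
  then show "finite {j. (i, j) \<in> D}"
    using assms by (meson ferrers_diagram_def finite_imageI finite_subset)
qed (use assms in \<open>unfold ferrers_diagram_def, fastforce+\<close>)

lemma ferrers_col:
  assumes "ferrers_diagram D" shows "{i. (i, j) \<in> D} = {1..col_len D j}"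
  unfolding col_len_def
proof (rule down_closed_eq_atLeastAtMost_card)
  have "{i. (i, j) \<in> D} \<subseteq> fst ` D" by force
  then show "finite {i. (i, j) \<in> D}"
    using assms by (meson ferrers_diagram_def finite_imageI finite_subset)
qed (use assms in \<open>unfold ferrers_diagram_def, fastforce+\<close>)

lemma ferrers_mem_row: "ferrers_diagram D \<Longrightarrow> (i, j) \<in> D \<longleftrightarrow> 1 \<le> j \<and> j \<le> row_len D i"
  using ferrers_row[of D i] by auto

lemma ferrers_mem_col: "ferrers_diagram D \<Longrightarrow> (i, j) \<in> D \<longleftrightarrow> 1 \<le> i \<and> i \<le> col_len D j"
  using ferrers_col[of D j] by auto

lemma ferrers_down:
  "ferrers_diagram D \<Longrightarrow> (i, j) \<in> D \<Longrightarrow> 1 \<le> i' \<Longrightarrow> i' \<le> i \<Longrightarrow> 1 \<le> j' \<Longrightarrow> j' \<le> j \<Longrightarrow> (i', j') \<in> D"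
  unfolding ferrers_diagram_def by blast

lemma ferrers_pos: "ferrers_diagram D \<Longrightarrow> (i, j) \<in> D \<Longrightarrow> 1 \<le> i \<and> 1 \<le> j"
  unfolding ferrers_diagram_def by blast

text \<open>Down-closed finite sets of boxes are exactly the diagrams of integer partitions.\<close>

lemma ferrers_diagram_iff_partition:
  "ferrers_diagram D \<longleftrightarrow>
     (\<exists>xs. sorted_wrt (\<ge>) xs \<and> 0 \<notin> set xs \<and>
        D = {(i, j). 1 \<le> i \<and> i \<le> length xs \<and> 1 \<le> j \<and> j \<le> xs ! (i - 1)})"
proof
  assume D: "ferrers_diagram D"
  define xs where "xs = map (\<lambda>i. row_len D (Suc i)) [0..<col_len D 1]"
  have nz: "row_len D i \<ge> 1" if "1 \<le> i" "i \<le> col_len D 1" for i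
    using ferrers_mem_row[OF D, of i 1] ferrers_mem_col[OF D, of i 1] that by auto
  have le: "row_len D i' \<le> row_len D i" if "1 \<le> i" "i \<le> i'" for i i'
  proof (cases "row_len D i' = 0")
    case False
    then have "(i', row_len D i') \<in> D" using ferrers_mem_row[OF D] by auto
    then have "(i, row_len D i') \<in> D" using ferrers_down[OF D] that False by fastforce
    then show ?thesis using ferrers_mem_row[OF D] by auto
  qed auto
  have "sorted_wrt (\<ge>) xs"
    unfolding xs_def sorted_wrt_iff_nth_less by (auto intro: le)
  moreover have "0 \<notin> set xs" unfolding xs_def
  proof
    assume "0 \<in> set (map (\<lambda>i. row_len D (Suc i)) [0..<col_len D 1])"
    then obtain i where "i < col_len D 1" "row_len D (Suc i) = 0" by auto
    then show False using nz[of "Suc i"] by simp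
  qed
  moreover have "D = {(i, j). 1 \<le> i \<and> i \<le> length xs \<and> 1 \<le> j \<and> j \<le> xs ! (i - 1)}"
  proof (rule set_eqI)
    fix b :: box obtain i j where b: "b = (i, j)" by force
    have "(i, j) \<in> D \<Longrightarrow> 1 \<le> i \<and> i \<le> col_len D 1"
      using ferrers_mem_col[OF D, of i 1] ferrers_down[OF D, of i j i 1] ferrers_pos[OF D] by auto
    then show "b \<in> D \<longleftrightarrow> b \<in> {(i, j). 1 \<le> i \<and> i \<le> length xs \<and> 1 \<le> j \<and> j \<le> xs ! (i - 1)}"
      unfolding b xs_def using ferrers_mem_row[OF D, of i j] by auto
  qed
  ultimately show "\<exists>xs. sorted_wrt (\<ge>) xs \<and> 0 \<notin> set xs \<and>
        D = {(i, j). 1 \<le> i \<and> i \<le> length xs \<and> 1 \<le> j \<and> j \<le> xs ! (i - 1)}" by blast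
next
  assume "\<exists>xs. sorted_wrt (\<ge>) xs \<and> 0 \<notin> set xs \<and>
        D = {(i, j). 1 \<le> i \<and> i \<le> length xs \<and> 1 \<le> j \<and> j \<le> xs ! (i - 1)}"
  then obtain xs :: "nat list" where xs: "sorted_wrt (\<ge>) xs"
    and D: "D = {(i, j). 1 \<le> i \<and> i \<le> length xs \<and> 1 \<le> j \<and> j \<le> xs ! (i - 1)}" by blast
  have "D \<subseteq> (SIGMA i:{1..length xs}. {1..xs ! (i - 1)})" unfolding D by auto
  then have "finite D" by (rule finite_subset) auto
  moreover have "xs ! (i - 1) \<le> xs ! (i' - 1)" if "1 \<le> i'" "i' \<le> i" "i \<le> length xs" for i i'
    using xs that unfolding sorted_wrt_iff_nth_less
    by (cases "i' = i") (auto simp: Suc_le_eq)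
  ultimately show "ferrers_diagram D"
    unfolding ferrers_diagram_def D by (fastforce dest: order_trans)
qed

text \<open>
  The protected area is the least Ferrers diagram that contains the box (1,1) and can be obtained
  by removing boxes of the first row and the first column only.
\<close>

lemma protected_area_least:
  assumes D: "ferrers_diagram D" and ne: "D \<noteq> {}"
  defines "R \<equiv> \<lambda>E. ferrers_diagram E \<and> (1, 1) \<in> E \<and> E \<subseteq> D \<and>
                   (\<forall>b \<in> D - E. fst b = 1 \<or> snd b = 1)"
  shows "R (protected_area D)" and "R E \<Longrightarrow> protected_area D \<subseteq> E"
proof -
  obtain i j where "(i, j) \<in> D" using ne by force
  then have c11: "(1, 1) \<in> D" using ferrers_down[OF D] ferrers_pos[OF D] by blast
  have r2: "row_len D 2 < j \<longleftrightarrow> (2, j) \<notin> D" if "1 \<le> j" for j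
    using ferrers_mem_row[OF D, of 2 j] that by auto
  have k2: "col_len D 2 < i \<longleftrightarrow> (i, 2) \<notin> D" if "1 \<le> i" for i
    using ferrers_mem_col[OF D, of i 2] that by auto
  have P: "(i, j) \<in> protected_area D \<longleftrightarrow>
      (i, j) \<in> D \<and> (i = 1 \<longrightarrow> j = 1 \<or> (2, j) \<in> D) \<and> (j = 1 \<longrightarrow> i = 1 \<or> (i, 2) \<in> D)" for i j
  proof (cases "(2, 2) \<in> D")
    case True
    then have "(2, 1) \<in> D" "(1, 2) \<in> D" using ferrers_down[OF D True] by auto
    then show ?thesis
      using True r2[of j] k2[of i] ferrers_pos[OF D, of i j] by (auto simp: protected_area_def)
  next
    case False
    have "\<not> (2 \<le> i \<and> 2 \<le> j)" if "(i, j) \<in> D" for i j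
      using ferrers_down[OF D that, of 2 2] False by auto
    then have "(i, j) \<in> D \<Longrightarrow> i = 1 \<or> j = 1" "(2, j) \<in> D \<Longrightarrow> j = 1" "(i, 2) \<in> D \<Longrightarrow> i = 1"
      using ferrers_pos[OF D, of i j] ferrers_pos[OF D, of 2 j] ferrers_pos[OF D, of i 2]
      by (metis One_nat_def Suc_1 le_antisym not_less_eq_eq le_refl)+
    then show ?thesis using False c11 by (auto simp: protected_area_def)
  qed
  have dn: "(i', j') \<in> protected_area D"
    if h: "(i, j) \<in> protected_area D" "1 \<le> i'" "i' \<le> i" "1 \<le> j'" "j' \<le> j" for i j i' j'
  proof -
    have m: "(i, j) \<in> D" using h(1) P by blast
    have 1: "(i', j') \<in> D" by (rule ferrers_down[OF D m]) (use h in auto)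
    have 2: "(2, j') \<in> D" if "i' = 1" "j' \<noteq> 1"
    proof (cases "i = 1")
      case True
      then have "(2, j) \<in> D" using h P[of i j] that by auto
      then show ?thesis using ferrers_down[OF D, of 2 j 2 j'] h by auto
    next
      case False
      then show ?thesis using ferrers_down[OF D m, of 2 j'] h by auto
    qed
    have 3: "(i', 2) \<in> D" if "j' = 1" "i' \<noteq> 1"
    proof (cases "j = 1")
      case True
      then have "(i, 2) \<in> D" using h P[of i j] that by auto
      then show ?thesis using ferrers_down[OF D, of i 2 i' 2] h by auto
    next
      case False
      then show ?thesis using ferrers_down[OF D m, of i' 2] h by auto
    qed
    show ?thesis using P 1 2 3 by blast
  qed
  have sub: "protected_area D \<subseteq> D" using P by auto
  then have "finite (protected_area D)" "protected_area D \<subseteq> {1..} \<times> {1..}"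
    using D finite_subset unfolding ferrers_diagram_def by blast+
  then have "ferrers_diagram (protected_area D)"
    unfolding ferrers_diagram_def using dn by blast
  then show "R (protected_area D)" unfolding R_def using P sub c11 by auto
  assume "R E"
  then have E: "ferrers_diagram E" "(1, 1) \<in> E"
    and DE: "\<And>i j. (i, j) \<in> D \<Longrightarrow> i \<noteq> 1 \<Longrightarrow> j \<noteq> 1 \<Longrightarrow> (i, j) \<in> E"
    unfolding R_def by force+
  show "protected_area D \<subseteq> E"
  proof
    fix b assume b: "b \<in> protected_area D"
    obtain i j where bij: "b = (i, j)" by force
    have "(i, j) \<in> E"
    proof (cases "i = 1"; cases "j = 1")
      assume "i = 1" "j \<noteq> 1"
      then have "(2, j) \<in> E" using b bij P DE by auto
      then show ?thesis using \<open>i = 1\<close> ferrers_down[OF E(1), of 2 j 1 j] ferrers_pos[OF E(1)] by auto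
    next
      assume "i \<noteq> 1" "j = 1"
      then have "(i, 2) \<in> E" using b bij P DE by auto
      then show ?thesis using \<open>j = 1\<close> ferrers_down[OF E(1), of i 2 i 1] ferrers_pos[OF E(1)] by auto
    qed (use E b bij P DE in auto)
    then show "b \<in> E" using bij by simp
  qed
qed

text \<open>The set counted by \<^const>\<open>num_protected\<close> is finite, so its cardinality is genuine.\<close>

lemma finite_SYT: "finite (SYT n)"
proof -
  let ?B = "{1..n} \<times> {1..n}"
  have "SYT n \<subseteq> (SIGMA D:Pow ?B. D \<rightarrow>\<^sub>E {1..n})"
  proof
    fix x assume x: "x \<in> SYT n"
    obtain D T where xDT: "x = (D, T)" by force
    have D: "ferrers_diagram D" and T: "T \<in> extensional D" "bij_betw T D {1..n}"
      using x xDT unfolding SYT_def by auto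
    have fin: "finite D" using D unfolding ferrers_diagram_def by blast
    have card: "card D = n" using bij_betw_same_card[OF T(2)] by simp
    have "i \<le> n \<and> j \<le> n" if "(i, j) \<in> D" for i j
    proof -
      have "Pair i ` {1..j} \<subseteq> D" "(\<lambda>i. (i, j)) ` {1..i} \<subseteq> D"
        using ferrers_down[OF D that] ferrers_pos[OF D that] by auto
      then have "card (Pair i ` {1..j}) \<le> n" "card ((\<lambda>i. (i, j)) ` {1..i}) \<le> n"
        using card_mono[OF fin] card by metis+
      then show ?thesis by (simp add: card_image inj_on_def)
    qed
    then have "D \<in> Pow ?B" using ferrers_pos[OF D] by auto
    moreover have "T \<in> D \<rightarrow>\<^sub>E {1..n}" using T by (auto simp: PiE_def bij_betw_def)
    ultimately show "x \<in> (SIGMA D:Pow ?B. D \<rightarrow>\<^sub>E {1..n})" using xDT by auto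
  qed
  moreover have "finite (SIGMA D:Pow ?B. D \<rightarrow>\<^sub>E {1..n})"
    by (intro finite_SigmaI) (auto intro!: finite_PiE intro: finite_subset)
  ultimately show ?thesis by (rule finite_subset)
qed

end

theory Submission
  imports Defs
begin

text \<open>
  The proof computes the numbers: \<open>p\<^sub>n\<^sub>,\<^sub>k = c * (n - m choose (k - l))\<close> with a factor \<open>c\<close>
  that does not depend on \<open>k\<close> (and \<open>p\<^sub>n\<^sub>,\<^sub>k = 0\<close> for \<open>k < l\<close>), so log-concavity is inherited from the rows of Pascal's triangle.

  The formula comes from cutting off the surplus. What remains of a tableau is its protected area
  with the entries it carries, which are just some of the numbers \<open>1, \<dots>, n\<close>; such a partially
  filled diagram is called a core below, and \<open>c\<close> is the number of cores. The shape of a core is its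
  own protected area, and every number that it misses exceeds all entries in its first row and
  first column. Conversely, the core says nothing about how the \<open>n - m\<close> missing numbers are
  distributed: an arm that prolongs the first row is compared only with the first row, and an arm
  that prolongs the first column only with the first column. Hence any \<open>k - l\<close> of the missing
  numbers may be put, in increasing order, to the end of the first row, and the others to the end
  of the first column. The choice of these \<open>k - l\<close> numbers determines the tableau.

  That the prolonged diagram has the old protected area, and that the protected area of a diagram
  is its own protected area, both follow from its characterisation as a least diagram
  (\<open>protected_area_least\<close>). The correspondence is \<open>bij_betw_cut\<close>, the formula is
  \<open>num_protected_eq\<close>.
\<close>

section \<open>Prolonging a diagram by two arms\<close>

definition prolong :: "box set \<Rightarrow> nat \<Rightarrow> nat \<Rightarrow> box set" where
  "prolong E a b = E \<union> {1} \<times> {row_len E 1<..row_len E 1 + a}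
                     \<union> {col_len E 1<..col_len E 1 + b} \<times> {1}"

lemma ferrers_corner: "ferrers_diagram D \<Longrightarrow> D \<noteq> {} \<Longrightarrow> (1, 1) \<in> D"
  by (metis ferrers_down ferrers_pos ex_in_conv le_refl surj_pair)

text \<open>A diagram that is its own protected area contains the corner, since the protected area of
  the empty diagram is by convention the single corner box.\<close>

lemma self_protected_corner:
  assumes "ferrers_diagram E" "protected_area E = E"
  shows "(1, 1) \<in> E"
proof -
  have "E \<noteq> {}" using assms(2) by (auto simp: protected_area_def)
  then show ?thesis by (rule ferrers_corner[OF assms(1)])
qed

lemma ferrers_prolong:
  assumes E: "ferrers_diagram E" and c: "(1, 1) \<in> E"
  shows "ferrers_diagram (prolong E a b)"
proof -
  have "finite (prolong E a b)" "prolong E a b \<subseteq> {1..} \<times> {1..}"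
    using E by (auto simp: ferrers_diagram_def prolong_def)
  moreover have "(i', j') \<in> prolong E a b"
    if h: "(i, j) \<in> prolong E a b" "1 \<le> i'" "i' \<le> i" "1 \<le> j'" "j' \<le> j" for i j i' j'
  proof -
    consider "(i, j) \<in> E" | "i = 1" "j \<le> row_len E 1 + a" | "j = 1" "i \<le> col_len E 1 + b"
      using h(1) by (auto simp: prolong_def)
    then show ?thesis
    proof cases
      case 1
      then show ?thesis using ferrers_down[OF E 1] h by (auto simp: prolong_def)
    next
      case 2
      then show ?thesis
        using h ferrers_mem_row[OF E, of 1 j'] by (auto simp: prolong_def)
    next
      case 3
      then show ?thesis
        using h ferrers_mem_col[OF E, of i' 1] by (auto simp: prolong_def)
    qed
  qed
  ultimately show ?thesis unfolding ferrers_diagram_def by blast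
qed

text \<open>The protected areas of \<open>E\<close> and of the prolonged diagram contain each other because each of
  them is a competitor in the minimality property of the other.\<close>

lemma protected_area_prolong:
  assumes E: "ferrers_diagram E" and self: "protected_area E = E"
  shows "protected_area (prolong E a b) = E"
proof -
  let ?D = "prolong E a b"
  have c: "(1, 1) \<in> E" by (rule self_protected_corner[OF assms])
  have D: "ferrers_diagram ?D" by (rule ferrers_prolong[OF E c])
  have sub: "E \<subseteq> ?D" by (auto simp: prolong_def)
  have Dne: "?D \<noteq> {}" and Ene: "E \<noteq> {}" using c sub by auto
  have below: "protected_area ?D \<subseteq> E"
    by (rule protected_area_least(2)[OF D Dne]) (use E c sub in \<open>auto simp: prolong_def\<close>)
  have "protected_area E \<subseteq> protected_area ?D"
    by (rule protected_area_least(2)[OF E Ene])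
      (use protected_area_least(1)[OF D Dne] below sub in blast)
  then show ?thesis using self below by blast
qed

lemma protected_area_idem:
  assumes D: "ferrers_diagram D" and ne: "D \<noteq> {}"
  shows "protected_area (protected_area D) = protected_area D"
proof -
  let ?E = "protected_area D"
  note R = protected_area_least(1)[OF D ne]
  then have E: "ferrers_diagram ?E" and Ene: "?E \<noteq> {}" by auto
  note R' = protected_area_least(1)[OF E Ene]
  have "?E \<subseteq> protected_area ?E"
    by (rule protected_area_least(2)[OF D ne]) (use R R' in blast)
  then show ?thesis using R' by blast
qed

lemma surplus_first_row:
  assumes D: "ferrers_diagram D" and ne: "D \<noteq> {}"
  shows "{s \<in> surplus D. fst s = 1} = {1} \<times> {row_len (protected_area D) 1<..row_len D 1}"
proof -
  have "ferrers_diagram (protected_area D)" using protected_area_least(1)[OF D ne] by blast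
  then show ?thesis
    using ferrers_mem_row[OF D] ferrers_mem_row[of "protected_area D"] by (auto simp: surplus_def)
qed

lemma surplus_first_column:
  assumes D: "ferrers_diagram D" and ne: "D \<noteq> {}"
  shows "{s \<in> surplus D. fst s \<noteq> 1} = {col_len (protected_area D) 1<..col_len D 1} \<times> {1}"
proof -
  note R = protected_area_least(1)[OF D ne]
  then have E: "ferrers_diagram (protected_area D)" by blast
  have "1 \<le> col_len (protected_area D) 1" using R ferrers_mem_col[OF E, of 1 1] by auto
  then show ?thesis
    using R ferrers_mem_col[OF D, of _ 1] ferrers_mem_col[OF E, of _ 1]
    by (auto simp: surplus_def)
qed

lemma protected_area_lens_le:
  assumes D: "ferrers_diagram D" and ne: "D \<noteq> {}"
  shows "row_len (protected_area D) 1 \<le> row_len D 1" "col_len (protected_area D) 1 \<le> col_len D 1"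
proof -
  note R = protected_area_least(1)[OF D ne]
  then have E: "ferrers_diagram (protected_area D)" by blast
  have "(1, row_len (protected_area D) 1) \<in> D" "(col_len (protected_area D) 1, 1) \<in> D"
    using R ferrers_mem_row[OF E, of 1 1] ferrers_mem_row[OF E, of 1 "row_len (protected_area D) 1"]
      ferrers_mem_col[OF E, of 1 1] ferrers_mem_col[OF E, of "col_len (protected_area D) 1" 1]
    by auto
  then show "row_len (protected_area D) 1 \<le> row_len D 1"
    "col_len (protected_area D) 1 \<le> col_len D 1"
    using ferrers_mem_row[OF D] ferrers_mem_col[OF D] by auto
qed

lemma prolong_protected_area:
  assumes D: "ferrers_diagram D" and ne: "D \<noteq> {}"
  shows "D = prolong (protected_area D) (row_len D 1 - row_len (protected_area D) 1)
                                        (col_len D 1 - col_len (protected_area D) 1)"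
proof -
  have "D = protected_area D \<union> {s \<in> surplus D. fst s = 1} \<union> {s \<in> surplus D. fst s \<noteq> 1}"
    using protected_area_least(1)[OF D ne] by (auto simp: surplus_def)
  then show ?thesis
    unfolding surplus_first_row[OF assms] surplus_first_column[OF assms]
    using protected_area_lens_le[OF assms] by (simp add: prolong_def)
qed

lemma row_len_prolong:
  assumes E: "ferrers_diagram E" and c: "(1, 1) \<in> E"
  shows "row_len (prolong E a b) 1 = row_len E 1 + a"
proof -
  have "1 \<le> col_len E 1" using c ferrers_mem_col[OF E, of 1 1] by auto
  then have "{j. (1, j) \<in> prolong E a b} =
      {j. (1, j) \<in> E} \<union> {row_len E 1<..row_len E 1 + a}"
    by (auto simp: prolong_def)
  also have "\<dots> = {1..row_len E 1 + a}"
    unfolding ferrers_row[OF E] by auto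
  finally show ?thesis by (simp add: row_len_def)
qed


section \<open>Filling the arms\<close>

text \<open>An arm must be filled in increasing order, so only the set of its entries can be chosen:
  box number \<open>t\<close> of the arm receives the \<open>t\<close>-th smallest element. Counting starts at 1.\<close>

definition nth_smallest :: "nat set \<Rightarrow> nat \<Rightarrow> nat" where
  "nth_smallest A t = sorted_list_of_set A ! (t - 1)"

lemma nth_smallest_less:
  "finite A \<Longrightarrow> 1 \<le> t \<Longrightarrow> t < u \<Longrightarrow> u \<le> card A \<Longrightarrow> nth_smallest A t < nth_smallest A u"
  unfolding nth_smallest_def
  by (rule sorted_wrt_nth_less[OF strict_sorted_list_of_set]) auto

lemma image_nth_smallest:
  assumes "finite A"
  shows "(\<lambda>j. nth_smallest A (j - r)) ` {r<..r + card A} = A"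
proof -
  have "(\<lambda>j. j - r - 1) ` {r<..r + card A} = {..<card A}"
  proof (intro equalityI subsetI)
    fix t assume "t \<in> {..<card A}"
    then show "t \<in> (\<lambda>j. j - r - 1) ` {r<..r + card A}"
      by (intro image_eqI[of _ _ "t + r + 1"]) auto
  qed auto
  then have "(\<lambda>j. nth_smallest A (j - r)) ` {r<..r + card A} =
      (!) (sorted_list_of_set A) ` {..<card A}"
    unfolding nth_smallest_def by (metis image_image)
  also have "\<dots> = A"
    using nth_image[of "card A" "sorted_list_of_set A"] assms by (simp flip: lessThan_atLeast0)
  finally show ?thesis .
qed

lemma nth_smallest_image_strict_mono:
  fixes f :: "nat \<Rightarrow> nat"
  assumes f: "strict_mono_on {r<..s} f" and j: "j \<in> {r<..s}"
  shows "nth_smallest (f ` {r<..s}) (j - r) = f j"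
proof -
  let ?xs = "map f [Suc r..<Suc s]"
  have "sorted_wrt (<) ?xs"
    unfolding sorted_wrt_iff_nth_less
    by (auto intro!: strict_mono_onD[OF f] simp del: upt_Suc)
  then have "sorted ?xs" "distinct ?xs" by (simp_all add: strict_sorted_iff)
  then have "sorted_list_of_set (f ` {r<..s}) = ?xs"
    using sorted_list_of_set.idem_if_sorted_distinct[of ?xs]
    by (simp add: atLeastLessThanSuc_atLeastAtMost atLeastSucAtMost_greaterThanAtMost del: upt_Suc)
  then show ?thesis using j by (auto simp: nth_smallest_def simp del: upt_Suc)
qed

text \<open>The set \<open>A\<close> holds the numbers that go to the first row; the remaining missing numbers go to
  the first column.\<close>

definition glue :: "nat \<Rightarrow> (box set \<times> (box \<Rightarrow> nat)) \<times> nat set \<Rightarrow> box set \<times> (box \<Rightarrow> nat)" where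
  "glue n = (\<lambda>((E, S), A). let B = {1..n} - S ` E - A; D = prolong E (card A) (card B) in
     (D, restrict (\<lambda>(i, j). if (i, j) \<in> E then S (i, j)
                            else if i = 1 then nth_smallest A (j - row_len E 1)
                            else nth_smallest B (i - col_len E 1)) D))"

definition cut :: "box set \<times> (box \<Rightarrow> nat) \<Rightarrow> (box set \<times> (box \<Rightarrow> nat)) \<times> nat set" where
  "cut = (\<lambda>(D, T). ((protected_area D, restrict T (protected_area D)),
                    T ` {s \<in> surplus D. fst s = 1}))"


section \<open>Cores\<close>

text \<open>A core keeps its entries as they are in the tableau, without renumbering them, so that it
  determines the set of missing numbers and hence how the surplus interleaves with the entries
  inside the protected area.\<close>

definition cores :: "nat \<Rightarrow> nat \<Rightarrow> nat \<Rightarrow> (box set \<times> (box \<Rightarrow> nat)) set" where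
  "cores l m n = {(E, S). ferrers_diagram E \<and> protected_area E = E \<and> card E = m \<and> row_len E 1 = l \<and>
     S \<in> extensional E \<and> inj_on S E \<and> S ` E \<subseteq> {1..n} \<and>
     (\<forall>i j j'. (i, j) \<in> E \<and> (i, j') \<in> E \<and> j < j' \<longrightarrow> S (i, j) < S (i, j')) \<and>
     (\<forall>i i' j. (i, j) \<in> E \<and> (i', j) \<in> E \<and> i < i' \<longrightarrow> S (i, j) < S (i', j)) \<and>
     (\<forall>b \<in> E. \<forall>x \<in> {1..n} - S ` E. fst b = 1 \<or> snd b = 1 \<longrightarrow> S b < x)}"

definition protected_tableaux ::
  "nat \<Rightarrow> nat \<Rightarrow> nat \<Rightarrow> nat \<Rightarrow> (box set \<times> (box \<Rightarrow> nat)) set" where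
  "protected_tableaux l m n k =
     {(D, T). (D, T) \<in> SYT n \<and> lm_protected l m (D, T) \<and> row_len D 1 = k}"

text \<open>The sum \<open>l + card A = k\<close>, instead of a difference of natural numbers, leaves no choice
  when \<open>k < l\<close>.\<close>

definition row_choices :: "nat \<Rightarrow> nat \<Rightarrow> nat \<Rightarrow> box set \<times> (box \<Rightarrow> nat) \<Rightarrow> nat set set" where
  "row_choices l n k = (\<lambda>(E, S). {A. A \<subseteq> {1..n} - S ` E \<and> l + card A = k})"

lemma SYT_nonempty:
  assumes "(D, T) \<in> SYT n" "n \<ge> 1"
  shows "D \<noteq> {}"
  using assms by (auto simp: SYT_def bij_betw_def)

lemma image_surplus:
  assumes "(D, T) \<in> SYT n" "n \<ge> 1"
  shows "T ` surplus D = {1..n} - T ` protected_area D"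
proof -
  have D: "ferrers_diagram D" and T: "bij_betw T D {1..n}" using assms by (auto simp: SYT_def)
  have "protected_area D \<subseteq> D"
    using protected_area_least(1)[OF D SYT_nonempty[OF assms]] by blast
  then show ?thesis
    using T inj_on_image_set_diff[of T D D "protected_area D"]
    by (auto simp: surplus_def bij_betw_def)
qed

lemma cut_in:
  assumes DT: "(D, T) \<in> protected_tableaux l m n k" and n: "n \<ge> 1"
  shows "cut (D, T) \<in> Sigma (cores l m n) (row_choices l n k)"
proof -
  let ?E = "protected_area D"
  have syt: "(D, T) \<in> SYT n" and prot: "lm_protected l m (D, T)" and k: "row_len D 1 = k"
    using DT by (auto simp: protected_tableaux_def)
  have D: "ferrers_diagram D" and T: "bij_betw T D {1..n}"
    and inc: "\<forall>i j j'. (i, j) \<in> D \<and> (i, j') \<in> D \<and> j < j' \<longrightarrow> T (i, j) < T (i, j')"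
      "\<forall>i i' j. (i, j) \<in> D \<and> (i', j) \<in> D \<and> i < i' \<longrightarrow> T (i, j) < T (i', j)"
    using syt by (auto simp: SYT_def)
  note ne = SYT_nonempty[OF syt n]
  note R = protected_area_least(1)[OF D ne]
  then have ED: "?E \<subseteq> D" and E: "ferrers_diagram ?E" by blast+
  have l: "row_len ?E 1 = l" and m: "card ?E = m" using prot by (auto simp: lm_protected_def)
  have missing: "{1..n} - T ` ?E = T ` surplus D" using image_surplus[OF syt n] by simp
  have "(?E, restrict T ?E) \<in> cores l m n"
    unfolding cores_def
  proof (intro CollectI case_prodI conjI)
    show "inj_on (restrict T ?E) ?E"
      using inj_on_subset[OF bij_betw_imp_inj_on[OF T] ED] by (simp add: inj_on_restrict_eq)
    show "restrict T ?E ` ?E \<subseteq> {1..n}" using T ED by (auto simp: bij_betw_def)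
    show "\<forall>b\<in>?E. \<forall>x\<in>{1..n} - restrict T ?E ` ?E. fst b = 1 \<or> snd b = 1 \<longrightarrow> restrict T ?E b < x"
    proof (intro ballI impI)
      fix b x assume b: "b \<in> ?E" "fst b = 1 \<or> snd b = 1"
        and x: "x \<in> {1..n} - restrict T ?E ` ?E"
      have "x \<in> T ` surplus D" using x unfolding missing[symmetric] by simp
      then show "restrict T ?E b < x" using prot b by (auto simp: lm_protected_def)
    qed
  qed (use E l m inc ED protected_area_idem[OF D ne] in \<open>auto simp: subset_iff\<close>)
  moreover have "T ` {s \<in> surplus D. fst s = 1} \<in> row_choices l n k (?E, restrict T ?E)"
  proof -
    have "inj_on T {s \<in> surplus D. fst s = 1}"
      using T by (rule inj_on_subset[OF bij_betw_imp_inj_on]) (auto simp: surplus_def)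
    then have "card (T ` {s \<in> surplus D. fst s = 1}) = k - l"
      unfolding surplus_first_row[OF D ne]
      by (simp only: card_image card_cartesian_product l k) simp
    moreover have "l \<le> k" using protected_area_lens_le[OF D ne] l k by simp
    moreover have "T ` {s \<in> surplus D. fst s = 1} \<subseteq> {1..n} - restrict T ?E ` ?E"
      using missing by auto
    ultimately show ?thesis by (simp add: row_choices_def)
  qed
  ultimately show ?thesis by (simp add: cut_def)
qed

text \<open>Nothing is lost by cutting: the entries of the column arm are the missing numbers outside
  the row arm, the two arms have the lengths of their entry sets, and an arm is increasing, so that
  its entry set determines its filling.\<close>

lemma glue_cut:
  assumes DT: "(D, T) \<in> SYT n" and n: "n \<ge> 1"
  shows "glue n (cut (D, T)) = (D, T)"
proof -
  define E where "E = protected_area D"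
  define r where "r = row_len E 1"
  define c where "c = col_len E 1"
  define A where "A = T ` {s \<in> surplus D. fst s = 1}"
  define B where "B = {1..n} - T ` E - A"
  have D: "ferrers_diagram D" and ext: "T \<in> extensional D" and T: "inj_on T D"
    and inc: "\<forall>i j j'. (i, j) \<in> D \<and> (i, j') \<in> D \<and> j < j' \<longrightarrow> T (i, j) < T (i, j')"
      "\<forall>i i' j. (i, j) \<in> D \<and> (i', j) \<in> D \<and> i < i' \<longrightarrow> T (i, j) < T (i', j)"
    using DT by (auto simp: SYT_def bij_betw_def)
  note ne = SYT_nonempty[OF DT n]
  note R = protected_area_least(1)[OF D ne, folded E_def]
  note row = surplus_first_row[OF D ne, folded E_def, folded r_def]
  note col = surplus_first_column[OF D ne, folded E_def, folded c_def]
  have "B = T ` surplus D - T ` {s \<in> surplus D. fst s = 1}"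
    unfolding B_def A_def E_def image_surplus[OF DT n] ..
  also have "\<dots> = T ` (surplus D - {s \<in> surplus D. fst s = 1})"
    by (rule inj_on_image_set_diff[OF T, symmetric]) (auto simp: surplus_def)
  also have "surplus D - {s \<in> surplus D. fst s = 1} = {s \<in> surplus D. fst s \<noteq> 1}" by auto
  finally have B: "B = T ` ({c<..col_len D 1} \<times> {1})" by (simp only: col)
  have A: "A = T ` ({1} \<times> {r<..row_len D 1})" by (simp only: A_def row)
  have rowD: "{1} \<times> {r<..row_len D 1} \<subseteq> D" and colD: "{c<..col_len D 1} \<times> {1} \<subseteq> D"
    unfolding row[symmetric] col[symmetric] by (auto simp: surplus_def)
  have cardA: "card A = row_len D 1 - r" and cardB: "card B = col_len D 1 - c"
    unfolding A B using rowD colD T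
    by (simp_all add: card_image[OF inj_on_subset] card_cartesian_product)
  have shape: "prolong E (card A) (card B) = D"
    using prolong_protected_area[OF D ne] by (simp add: cardA cardB E_def r_def c_def)
  have rowval: "nth_smallest A (j - r) = T (1, j)" if "j \<in> {r<..row_len D 1}" for j
  proof -
    have "strict_mono_on {r<..row_len D 1} (\<lambda>j. T (1, j))"
      using inc rowD by (auto simp: strict_mono_on_def subset_iff)
    moreover have "A = (\<lambda>j. T (1, j)) ` {r<..row_len D 1}" unfolding A by force
    ultimately show ?thesis using nth_smallest_image_strict_mono that by metis
  qed
  have colval: "nth_smallest B (i - c) = T (i, 1)" if "i \<in> {c<..col_len D 1}" for i
  proof -
    have "strict_mono_on {c<..col_len D 1} (\<lambda>i. T (i, 1))"
      using inc colD by (auto simp: strict_mono_on_def subset_iff)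
    moreover have "B = (\<lambda>i. T (i, 1)) ` {c<..col_len D 1}" unfolding B by force
    ultimately show ?thesis using nth_smallest_image_strict_mono that by metis
  qed
  have "restrict (\<lambda>(i, j). if (i, j) \<in> E then restrict T E (i, j) else if i = 1
           then nth_smallest A (j - r) else nth_smallest B (i - c)) D = T"
  proof (rule extensionalityI[OF restrict_extensional ext])
    fix b assume b: "b \<in> D"
    obtain i j where ij: "b = (i, j)" by force
    have sur: "(i, j) \<in> surplus D" if "(i, j) \<notin> E" using b ij that by (simp add: surplus_def E_def)
    have "j \<in> {r<..row_len D 1}" if "(i, j) \<notin> E" "i = 1"
    proof -
      have "(i, j) \<in> {s \<in> surplus D. fst s = 1}" using sur that by simp
      then show ?thesis unfolding row by simp
    qed
    moreover have "j = 1 \<and> i \<in> {c<..col_len D 1}" if "(i, j) \<notin> E" "i \<noteq> 1"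
    proof -
      have "(i, j) \<in> {s \<in> surplus D. fst s \<noteq> 1}" using sur that by simp
      then show ?thesis unfolding col by simp
    qed
    ultimately show "restrict (\<lambda>(i, j). if (i, j) \<in> E then restrict T E (i, j) else if i = 1
           then nth_smallest A (j - r) else nth_smallest B (i - c)) D b = T b"
      using b ij rowval colval by auto
  qed
  moreover have "cut (D, T) = ((E, restrict T E), A)"
    by (simp add: cut_def E_def A_def)
  moreover have "restrict T E ` E = T ` E" by simp
  ultimately show ?thesis
    by (simp only: glue_def prod.case Let_def B_def[symmetric] shape r_def[symmetric]
        c_def[symmetric])
qed

text \<open>Glueing arms to a core gives a tableau because an arm meets the rest of the diagram only in
  the first row or the first column, whose entries in the core are smaller than all missing
  numbers.\<close>

lemma glue_in:
  assumes ES: "(E, S) \<in> cores l m n" and A: "A \<in> row_choices l n k (E, S)"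
  shows "glue n ((E, S), A) \<in> protected_tableaux l m n k" (is ?in)
    and "cut (glue n ((E, S), A)) = ((E, S), A)" (is ?inv)
proof -
  define B where "B = {1..n} - S ` E - A"
  define r where "r = row_len E 1"
  define c where "c = col_len E 1"
  define D where "D = prolong E (card A) (card B)"
  define T where "T = restrict (\<lambda>(i, j). if (i, j) \<in> E then S (i, j) else if i = 1
           then nth_smallest A (j - r) else nth_smallest B (i - c)) D"
  define Row where "Row = {1::nat} \<times> {r<..r + card A}"
  define Col where "Col = {c<..c + card B} \<times> {1::nat}"
  have glue: "glue n ((E, S), A) = (D, T)"
    unfolding glue_def by (simp only: B_def D_def T_def r_def c_def Let_def prod.case)
  have E: "ferrers_diagram E" and self: "protected_area E = E" and m: "card E = m"
    and l: "row_len E 1 = l" and ext: "S \<in> extensional E" and inj: "inj_on S E"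
    and Sn: "S ` E \<subseteq> {1..n}"
    and rows: "\<And>i j j'. (i, j) \<in> E \<Longrightarrow> (i, j') \<in> E \<Longrightarrow> j < j' \<Longrightarrow> S (i, j) < S (i, j')"
    and cols: "\<And>i i' j. (i, j) \<in> E \<Longrightarrow> (i', j) \<in> E \<Longrightarrow> i < i' \<Longrightarrow> S (i, j) < S (i', j)"
    and large: "\<And>b x. b \<in> E \<Longrightarrow> x \<in> {1..n} - S ` E \<Longrightarrow> fst b = 1 \<or> snd b = 1 \<Longrightarrow> S b < x"
    using ES unfolding cores_def by blast+
  have Asub: "A \<subseteq> {1..n} - S ` E" and k: "l + card A = k"
    using A by (auto simp: row_choices_def)
  have fin: "finite A" "finite B" using finite_subset[OF Asub] by (auto simp: B_def)
  have corner: "(1, 1) \<in> E" by (rule self_protected_corner[OF E self])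
  have Erow: "(1, j) \<in> E \<longleftrightarrow> 1 \<le> j \<and> j \<le> r" for j using ferrers_mem_row[OF E] by (simp add: r_def)
  have Ecol: "(i, 1) \<in> E \<longleftrightarrow> 1 \<le> i \<and> i \<le> c" for i using ferrers_mem_col[OF E] by (simp add: c_def)
  have rc: "1 \<le> r" "1 \<le> c" using corner Erow[of 1] Ecol[of 1] by auto
  have D: "ferrers_diagram D" unfolding D_def by (rule ferrers_prolong[OF E corner])
  have pD: "protected_area D = E" unfolding D_def by (rule protected_area_prolong[OF E self])
  have Dk: "row_len D 1 = k" unfolding D_def row_len_prolong[OF E corner] using l k by simp
  have Dun: "D = E \<union> Row \<union> Col" by (auto simp: D_def prolong_def Row_def Col_def r_def c_def)
  have disj: "E \<inter> Row = {}" "E \<inter> Col = {}" "Row \<inter> Col = {}"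
    using Erow Ecol rc by (auto simp: Row_def Col_def)
  have sur: "surplus D = Row \<union> Col" unfolding surplus_def pD using Dun disj by blast
  have surrow: "{s \<in> surplus D. fst s = 1} = Row"
    using rc by (auto simp: sur Row_def Col_def)
  have TE: "T b = S b" if "b \<in> E" for b
    using that by (cases b) (auto simp: T_def Dun)
  have TR: "T (1, j) = nth_smallest A (j - r)" if "(1, j) \<in> Row" for j
    using that disj by (auto simp: T_def Dun)
  have TC: "T (i, 1) = nth_smallest B (i - c)" if "(i, 1) \<in> Col" for i
    using that disj rc by (auto simp: T_def Dun Col_def)
  have imE: "T ` E = S ` E" using TE by (rule image_cong[OF refl])
  have "T ` Row = (\<lambda>j. T (1, j)) ` {r<..r + card A}" unfolding Row_def by force
  also have "\<dots> = (\<lambda>j. nth_smallest A (j - r)) ` {r<..r + card A}"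
    by (rule image_cong[OF refl]) (use TR in \<open>auto simp: Row_def\<close>)
  finally have imR: "T ` Row = A" using image_nth_smallest[OF fin(1)] by simp
  have "T ` Col = (\<lambda>i. T (i, 1)) ` {c<..c + card B}" unfolding Col_def by force
  also have "\<dots> = (\<lambda>i. nth_smallest B (i - c)) ` {c<..c + card B}"
    by (rule image_cong[OF refl]) (use TC in \<open>auto simp: Col_def\<close>)
  finally have imC: "T ` Col = B" using image_nth_smallest[OF fin(2)] by simp
  have img: "T ` D = {1..n}"
    unfolding Dun image_Un imE imR imC using Sn Asub by (auto simp: B_def)
  \<comment> \<open>The shape has as many boxes as there are entries, so surjectivity gives injectivity.\<close>
  have finE: "finite E" using E by (simp add: ferrers_diagram_def)
  have "card D = card E + card A + card B"
  proof -
    have "finite Row" "finite Col" "card Row = card A" "card Col = card B"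
      by (simp_all add: Row_def Col_def card_cartesian_product)
    then show ?thesis
      unfolding Dun using finE disj by (simp add: card_Un_disjoint Int_Un_distrib2)
  qed
  also have "\<dots> = card (S ` E \<union> A \<union> B)"
  proof -
    have "S ` E \<inter> A = {}" "(S ` E \<union> A) \<inter> B = {}" using Asub by (auto simp: B_def)
    then show ?thesis using finE fin by (simp add: card_Un_disjoint card_image[OF inj])
  qed
  also have "S ` E \<union> A \<union> B = T ` D" by (simp add: Dun image_Un imE imR imC)
  finally have injT: "inj_on T D"
    using D by (intro eq_card_imp_inj_on) (auto simp: ferrers_diagram_def)
  have arm: "T b < T s" if "b \<in> E" "s \<in> Row \<union> Col" "fst b = 1 \<or> snd b = 1" for b s
  proof -
    have "T s \<in> A \<union> B" using that(2) imR imC by blast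
    then show ?thesis using large[of b "T s"] that TE Asub by (auto simp: B_def)
  qed
  have inc_row: "T (i, j) < T (i, j')" if h: "(i, j) \<in> D" "(i, j') \<in> D" "j < j'" for i j j'
  proof -
    have j: "1 \<le> i" "1 \<le> j" using ferrers_pos[OF D h(1)] by auto
    consider "(i, j') \<in> E" | "(i, j') \<in> Row" "(i, j) \<in> E" | "(i, j') \<in> Row" "(i, j) \<in> Row"
    proof -
      have "(i, j') \<notin> Col" using j h(3) by (auto simp: Col_def)
      moreover have "(i, j) \<notin> Col" if "(i, j') \<in> Row" using that rc by (auto simp: Row_def Col_def)
      ultimately show ?thesis using h that unfolding Dun by blast
    qed
    then show ?thesis
    proof cases
      case 1
      then have "(i, j) \<in> E" using ferrers_down[OF E 1, of i j] j h(3) by auto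
      then show ?thesis using 1 rows h(3) TE by auto
    next
      case 2
      then show ?thesis using arm by (auto simp: Row_def)
    next
      case 3
      then have "i = 1" "j - r < j' - r" "1 \<le> j - r" "j' - r \<le> card A"
        using h(3) by (auto simp: Row_def)
      then show ?thesis using 3 TR nth_smallest_less[OF fin(1)] by auto
    qed
  qed
  have inc_col: "T (i, j) < T (i', j)" if h: "(i, j) \<in> D" "(i', j) \<in> D" "i < i'" for i i' j
  proof -
    have i: "1 \<le> i" "1 \<le> j" using ferrers_pos[OF D h(1)] by auto
    consider "(i', j) \<in> E" | "(i', j) \<in> Col" "(i, j) \<in> E" | "(i', j) \<in> Col" "(i, j) \<in> Col"
    proof -
      have "(i', j) \<notin> Row" using i h(3) by (auto simp: Row_def)
      moreover have "(i, j) \<notin> Row" if "(i', j) \<in> Col" using that rc by (auto simp: Row_def Col_def)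
      ultimately show ?thesis using h that unfolding Dun by blast
    qed
    then show ?thesis
    proof cases
      case 1
      then have "(i, j) \<in> E" using ferrers_down[OF E 1, of i j] i h(3) by auto
      then show ?thesis using 1 cols h(3) TE by auto
    next
      case 2
      then show ?thesis using arm by (auto simp: Col_def)
    next
      case 3
      then have "j = 1" "i - c < i' - c" "1 \<le> i - c" "i' - c \<le> card B"
        using h(3) by (auto simp: Col_def)
      then show ?thesis using 3 TC nth_smallest_less[OF fin(2)] by auto
    qed
  qed
  have "(D, T) \<in> SYT n"
    using D injT img inc_row inc_col by (auto simp: SYT_def bij_betw_def T_def)
  moreover have "lm_protected l m (D, T)"
    using arm m l by (auto simp: lm_protected_def sur pD)
  ultimately show ?in unfolding glue using Dk by (simp add: protected_tableaux_def)
  have "restrict T E = S"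
    by (rule extensionalityI[OF restrict_extensional ext]) (simp add: TE)
  then show ?inv unfolding glue cut_def using surrow imR by (simp add: pD)
qed

lemma bij_betw_cut:
  assumes "n \<ge> 1"
  shows "bij_betw cut (protected_tableaux l m n k) (Sigma (cores l m n) (row_choices l n k))"
proof (rule bij_betw_byWitness[where f' = "glue n"])
  show "\<forall>x\<in>protected_tableaux l m n k. glue n (cut x) = x"
    using glue_cut[OF _ assms] by (auto simp: protected_tableaux_def)
  show "\<forall>y\<in>Sigma (cores l m n) (row_choices l n k). cut (glue n y) = y"
    using glue_in(2) by auto
  show "cut ` protected_tableaux l m n k \<subseteq> Sigma (cores l m n) (row_choices l n k)"
    using cut_in[OF _ assms] by force
  show "glue n ` Sigma (cores l m n) (row_choices l n k) \<subseteq> protected_tableaux l m n k"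
    using glue_in(1) by force
qed


section \<open>Counting\<close>

lemma finite_cores: "finite (cores l m n)"
proof -
  \<comment> \<open>A column or a row of a diagram with \<open>m\<close> boxes has length at most \<open>m\<close>.\<close>
  have "cores l m n \<subseteq> (SIGMA E:Pow ({1..m} \<times> {1..m}). E \<rightarrow>\<^sub>E {1..n})"
  proof
    fix x assume x: "x \<in> cores l m n"
    obtain E S where ES: "x = (E, S)" by force
    have E: "ferrers_diagram E" and m: "card E = m" and S: "S \<in> E \<rightarrow>\<^sub>E {1..n}"
      using x ES by (auto simp: cores_def PiE_def)
    have fin: "finite E" using E unfolding ferrers_diagram_def by blast
    have "i \<le> m \<and> j \<le> m" if "(i, j) \<in> E" for i j
    proof -
      have "Pair i ` {1..j} \<subseteq> E" "(\<lambda>i. (i, j)) ` {1..i} \<subseteq> E"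
        using ferrers_down[OF E that] ferrers_pos[OF E that] by auto
      then have "card (Pair i ` {1..j}) \<le> m" "card ((\<lambda>i. (i, j)) ` {1..i}) \<le> m"
        using card_mono[OF fin] m by metis+
      then show ?thesis by (simp add: card_image inj_on_def)
    qed
    then have "E \<in> Pow ({1..m} \<times> {1..m})" using ferrers_pos[OF E] by auto
    then show "x \<in> (SIGMA E:Pow ({1..m} \<times> {1..m}). E \<rightarrow>\<^sub>E {1..n})" using ES S by auto
  qed
  moreover have "finite (SIGMA E:Pow ({1..m} \<times> {1..m}). E \<rightarrow>\<^sub>E {1..n})"
    by (intro finite_SigmaI) (auto intro!: finite_PiE intro: finite_subset)
  ultimately show ?thesis by (rule finite_subset)
qed

lemma card_row_choices:
  assumes "(E, S) \<in> cores l m n"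
  shows "card (row_choices l n k (E, S)) = (if k < l then 0 else (n - m) choose (k - l))"
proof (cases "k < l")
  case True
  then have "row_choices l n k (E, S) = {}" by (auto simp: row_choices_def)
  then show ?thesis using True by simp
next
  case False
  have "inj_on S E" "S ` E \<subseteq> {1..n}" "card E = m" using assms by (auto simp: cores_def)
  then have "card ({1..n} - S ` E) = n - m"
    by (simp add: card_Diff_subset card_image finite_subset)
  moreover have "row_choices l n k (E, S) = {A. A \<subseteq> {1..n} - S ` E \<and> card A = k - l}"
    using False by (auto simp: row_choices_def)
  ultimately show ?thesis using False n_subsets[of "{1..n} - S ` E" "k - l"] by simp
qed

lemma num_protected_eq:
  assumes "n \<ge> 1"
  shows "num_protected l m n k =
    (if k < l then 0 else card (cores l m n) * ((n - m) choose (k - l)))"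
proof -
  have "num_protected l m n k = card (Sigma (cores l m n) (row_choices l n k))"
    using bij_betw_same_card[OF bij_betw_cut[OF assms]]
    unfolding num_protected_def protected_tableaux_def .
  also have "\<dots> = (\<Sum>x\<in>cores l m n. card (row_choices l n k x))"
  proof (rule card_SigmaI[OF finite_cores])
    have "row_choices l n k x \<subseteq> Pow {1..n}" for x by (auto simp: row_choices_def)
    then show "\<forall>x\<in>cores l m n. finite (row_choices l n k x)"
      by (blast intro: finite_subset[of _ "Pow {1..n}"] finite_Pow_iff[THEN iffD2]
          finite_atLeastAtMost)
  qed
  also have "\<dots> = (\<Sum>x\<in>cores l m n. if k < l then 0 else (n - m) choose (k - l))"
    by (rule sum.cong) (use card_row_choices in auto)
  finally show ?thesis by simp
qed

text \<open>The quotients of neighbours in a row of Pascal's triangle decrease: those at \<open>j\<close> and at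
  \<open>j + 1\<close> are \<open>(N - j) / (j + 1)\<close> and \<open>(N - j - 1) / (j + 2)\<close>.\<close>

lemma binomial_log_concave:
  "(N choose j) * (N choose Suc (Suc j)) \<le> (N choose Suc j)\<^sup>2"
proof (cases "Suc j \<le> N")
  case True
  let ?x = "N choose j" and ?y = "N choose Suc j" and ?z = "N choose Suc (Suc j)"
  define d where "d = N - Suc j"
  have 1: "Suc j * ?y = Suc d * ?x"
    using binomial_absorb_comp[of N j] binomial_absorption[of j N] True
    by (simp add: d_def Suc_diff_Suc mult.commute)
  have 2: "Suc (Suc j) * ?z = d * ?y"
    using binomial_absorb_comp[of N "Suc j"] binomial_absorption[of "Suc j" N]
    by (simp add: d_def)
  have "Suc (Suc j) * Suc d * (?x * ?z) = (Suc d * ?x) * (Suc (Suc j) * ?z)"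
    by (simp only: ac_simps)
  also have "\<dots> = (Suc j * d) * ?y\<^sup>2"
    by (simp only: 1[symmetric] 2 power2_eq_square ac_simps)
  also have "\<dots> \<le> (Suc (Suc j) * Suc d) * ?y\<^sup>2"
    by (intro mult_right_mono mult_mono) auto
  finally show ?thesis by (simp del: mult_Suc mult_Suc_right)
qed (simp add: binomial_eq_0)

theorem theorem3p9:
  fixes n l m :: nat
  assumes "n \<ge> 1"
  shows "log_concave n (num_protected l m n)"
  unfolding log_concave_def
proof (intro allI impI)
  fix k assume k: "2 \<le> k \<and> k \<le> n - 1"
  let ?c = "card (cores l m n)"
  show "num_protected l m n (k - 1) * num_protected l m n (k + 1) \<le> (num_protected l m n k)\<^sup>2"
  proof (cases "k - 1 < l")
    case True
    then show ?thesis by (simp add: num_protected_eq[OF assms])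
  next
    case False
    define j where "j = k - 1 - l"
    have "k - 1 - l = j" "k - l = Suc j" "k + 1 - l = Suc (Suc j)" "\<not> k < l" "\<not> k + 1 < l"
      using False k by (auto simp: j_def)
    then have "num_protected l m n (k - 1) * num_protected l m n (k + 1) =
        ?c\<^sup>2 * (((n - m) choose j) * ((n - m) choose Suc (Suc j)))"
      and "(num_protected l m n k)\<^sup>2 = ?c\<^sup>2 * ((n - m) choose Suc j)\<^sup>2"
      using False by (simp_all add: num_protected_eq[OF assms] power2_eq_square)
    then show ?thesis using binomial_log_concave[of "n - m" j] by simp
  qed
qed

end
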